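(* The constructions $P_\tau$ and $\hat P$, given on objects by $X\mapsto P_\tau(X)$ and $X\mapsto \hat P(X)$, and on a continuous map $f:X\to Y$ of Tychonoff spaces by the restrictions $P_\tau(f)=P(\beta f)|_{P_\tau(X)}:P_\tau(X)\to P_\tau(Y)$ and $\hat P(f)=P(\beta f)|_{\hat P(X)}:\hat P(X)\to\hat P(Y)$, are (well-defined) covariant functors from the category of Tychonoff spaces and their continuous maps to itself, and both extend the functor $P$ of probability measures on the category of compact Hausdorff spaces.
   Context: For a compact Hausdorff space $K$, $P(K)$ is the space of regular countably additive Borel probability measures on $K$, with the coarsest topology making $\mu\mapsto\int\varphi\,d\mu$ continuous for every $\varphi\in C(K)$; for a continuous map $g:K\to L$ of compact Hausdorff spaces, $P(g)(\mu)(B)=\mu(g^{-1}(B))$ for Borel $B\subset L$. For a Tychonoff space $X$, $\beta X$ is its Stone-Čech compactification, and for continuous $f:X\to Y$, $\beta f:\beta X\to\beta Y$ is the continuous extension of $f$. For $\mu\in P(\beta X)$ put $\mu^*(X)=\inf\{\mu(B): X\subset B,\ B \text{ Borel in }\beta X\}$ and $\mu_*(X)=\sup\{\mu(B): B\subset X,\ B\text{ Borel in }\beta X\}$. Define the subspaces $P_\tau(X)=\{\mu\in P(\beta X):\mu^*(X)=1\}$ and $\hat P(X)=\{\mu\in P(\beta X):\mu_*(X)=1\}$ of $P(\beta X)$. *)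

theory Defs
  imports "HOL-Probability.Probability_Measure"
begin

section \<open>Tychonoff spaces and their continuous maps\<close>

definition tychonoff_space :: "'a topology \<Rightarrow> bool" where
  "tychonoff_space X \<longleftrightarrow> completely_regular_space X \<and> Hausdorff_space X"

text \<open>
  Morphisms are continuous maps made extensional (value \<open>undefined\<close> off the source space), so that
  equality of morphisms is equality of HOL functions. The identity of \<open>X\<close> is
  \<open>restrict id (topspace X)\<close>, and composition of \<open>f\<close> with \<open>g\<close> is \<open>compose (topspace X) g f\<close>.
\<close>

definition cmaps :: "'a topology \<Rightarrow> 'b topology \<Rightarrow> ('a \<Rightarrow> 'b) set" where
  "cmaps X Y = {f \<in> extensional (topspace X). continuous_map X Y f}"


section \<open>The Stone-Cech compactification\<close>

text \<open>
  \<open>\<beta>X\<close> is the closure of the image of \<open>X\<close> under the evaluation map into the cube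
  \<open>[0,1]\<^bsup>C(X,[0,1])\<^esup>\<close>. Since \<open>X\<close> is not literally a subset of this space, the inclusion
  \<open>X \<subseteq> \<beta>X\<close> is the map \<open>sc_embed X\<close>.
\<close>

abbreviation unit_maps :: "'a topology \<Rightarrow> ('a \<Rightarrow> real) set" where
  "unit_maps X \<equiv> cmaps X (top_of_set {0..1})"

definition sc_cube :: "'a topology \<Rightarrow> (('a \<Rightarrow> real) \<Rightarrow> real) topology" where
  "sc_cube X = product_topology (\<lambda>_. top_of_set {0..1}) (unit_maps X)"

definition sc_embed :: "'a topology \<Rightarrow> 'a \<Rightarrow> ('a \<Rightarrow> real) \<Rightarrow> real" where
  "sc_embed X = (\<lambda>x\<in>topspace X. \<lambda>h\<in>unit_maps X. h x)"

definition stone_cech :: "'a topology \<Rightarrow> (('a \<Rightarrow> real) \<Rightarrow> real) topology" where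
  "stone_cech X = subtopology (sc_cube X) (sc_cube X closure_of (sc_embed X ` topspace X))"

text \<open>
  \<open>stone_cech_map X Y f\<close> is \<open>\<beta>f\<close>, the continuous extension of \<open>f\<close>. The description is proper by
  \<open>ex1_stone_cech_map\<close> below.
\<close>

definition stone_cech_map ::
  "'a topology \<Rightarrow> 'b topology \<Rightarrow> ('a \<Rightarrow> 'b) \<Rightarrow> (('a \<Rightarrow> real) \<Rightarrow> real) \<Rightarrow> (('b \<Rightarrow> real) \<Rightarrow> real)" where
  "stone_cech_map X Y f =
     (THE F. F \<in> cmaps (stone_cech X) (stone_cech Y) \<and>
             (\<forall>x\<in>topspace X. F (sc_embed X x) = sc_embed Y (f x)))"


section \<open>Spaces of probability measures\<close>

definition borel_sigma :: "'a topology \<Rightarrow> 'a measure" where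
  "borel_sigma K = sigma (topspace K) {U. openin K U}"

definition regular_measure_on :: "'a topology \<Rightarrow> 'a measure \<Rightarrow> bool" where
  "regular_measure_on K M \<longleftrightarrow>
     (\<forall>B\<in>sets M. emeasure M B = (SUP C\<in>{C. compactin K C \<and> C \<subseteq> B}. emeasure M C) \<and>
                 emeasure M B = (INF U\<in>{U. openin K U \<and> B \<subseteq> U}. emeasure M U))"

definition prob_measures :: "'a topology \<Rightarrow> 'a measure set" where
  "prob_measures K =
     {M. space M = topspace K \<and> sets M = sets (borel_sigma K) \<and> prob_space M \<and> regular_measure_on K M}"

definition P_space :: "'a topology \<Rightarrow> 'a measure topology" where
  "P_space K = topology_generated_by
     {{M \<in> prob_measures K. (\<integral>x. \<phi> x \<partial>M) \<in> U} | \<phi> U. continuous_map K euclideanreal \<phi> \<and> open U}"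

definition P_map :: "'a topology \<Rightarrow> 'b topology \<Rightarrow> ('a \<Rightarrow> 'b) \<Rightarrow> 'a measure \<Rightarrow> 'b measure" where
  "P_map K L g = (\<lambda>M\<in>prob_measures K. distr M (borel_sigma L) g)"

text \<open>\<open>outer_measure_of\<close> is the outer measure of the library; the inner measure is its dual.\<close>

definition inner_measure_of :: "'a measure \<Rightarrow> 'a set \<Rightarrow> ennreal" where
  "inner_measure_of M A = (SUP B\<in>{B\<in>sets M. B \<subseteq> A}. emeasure M B)"

definition P_tau :: "'a topology \<Rightarrow> (('a \<Rightarrow> real) \<Rightarrow> real) measure topology" where
  "P_tau X = subtopology (P_space (stone_cech X))
     {M. outer_measure_of M (sc_embed X ` topspace X) = 1}"

definition P_hat :: "'a topology \<Rightarrow> (('a \<Rightarrow> real) \<Rightarrow> real) measure topology" where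
  "P_hat X = subtopology (P_space (stone_cech X))
     {M. inner_measure_of M (sc_embed X ` topspace X) = 1}"

definition P_tau_map :: "'a topology \<Rightarrow> 'b topology \<Rightarrow> ('a \<Rightarrow> 'b) \<Rightarrow>
    (('a \<Rightarrow> real) \<Rightarrow> real) measure \<Rightarrow> (('b \<Rightarrow> real) \<Rightarrow> real) measure" where
  "P_tau_map X Y f =
     restrict (P_map (stone_cech X) (stone_cech Y) (stone_cech_map X Y f)) (topspace (P_tau X))"

definition P_hat_map :: "'a topology \<Rightarrow> 'b topology \<Rightarrow> ('a \<Rightarrow> 'b) \<Rightarrow>
    (('a \<Rightarrow> real) \<Rightarrow> real) measure \<Rightarrow> (('b \<Rightarrow> real) \<Rightarrow> real) measure" where
  "P_hat_map X Y f =
     restrict (P_map (stone_cech X) (stone_cech Y) (stone_cech_map X Y f)) (topspace (P_hat X))"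


section \<open>The definitions are proper\<close>

lemma topspace_P_space: "topspace (P_space K) = prob_measures K"
proof -
  have "\<exists>\<phi> U. prob_measures K = {M \<in> prob_measures K. (\<integral>x. \<phi> x \<partial>M) \<in> U} \<and>
      continuous_map K euclideanreal \<phi> \<and> open U"
    by (rule exI[of _ "\<lambda>_. 0"], rule exI[of _ UNIV]) auto
  then show ?thesis
    unfolding P_space_def topology_generated_by_topspace by blast
qed

lemma compact_space_stone_cech: "compact_space (stone_cech X)"
proof -
  have "compact_space (sc_cube X)"
    by (simp add: sc_cube_def compact_space_product_topology compact_space_subtopology)
  then show ?thesis
    unfolding stone_cech_def
    by (simp add: closedin_compact_space compact_space_subtopology)
qed

lemma Hausdorff_space_sc_cube: "Hausdorff_space (sc_cube X)"
  by (simp add: sc_cube_def Hausdorff_space_product_topology Hausdorff_space_subtopology)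

lemma Hausdorff_space_stone_cech: "Hausdorff_space (stone_cech X)"
  by (simp add: stone_cech_def Hausdorff_space_sc_cube Hausdorff_space_subtopology)

lemma continuous_map_sc_embed_cube: "continuous_map X (sc_cube X) (sc_embed X)"
proof -
  have "continuous_map X (sc_cube X) (\<lambda>x. \<lambda>h\<in>unit_maps X. h x)"
    unfolding sc_cube_def
    by (auto simp: continuous_map_componentwise cmaps_def)
  then show ?thesis
    by (rule continuous_map_eq) (simp add: sc_embed_def)
qed

lemma sc_embed_subset: "sc_embed X ` topspace X \<subseteq> topspace (sc_cube X)"
  using continuous_map_image_subset_topspace[OF continuous_map_sc_embed_cube] .

lemma continuous_map_sc_embed: "continuous_map X (stone_cech X) (sc_embed X)"
  unfolding stone_cech_def continuous_map_in_subtopology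
  using continuous_map_sc_embed_cube closure_of_subset[OF sc_embed_subset[of X]] by blast

lemma sc_embed_dense: "stone_cech X closure_of (sc_embed X ` topspace X) = topspace (stone_cech X)"
  unfolding stone_cech_def
  by (simp add: closure_of_subtopology closure_of_subset sc_embed_subset Int_absorb1
      closure_of_subset_topspace)

lemma unit_maps_eq:
  "unit_maps X = mspace (submetric (cfunspace X euclidean_metric) {f. f \<in> topspace X \<rightarrow> {0..1::real}})"
proof -
  have "bounded (f ` topspace X)" if "f \<in> topspace X \<rightarrow> {0..1::real}" for f
    using that by (intro bounded_subset[OF bounded_closed_interval[of 0 1]]) auto
  then show ?thesis
    by (auto simp: cmaps_def continuous_map_in_subtopology)
qed

text \<open>For Tychonoff \<open>X\<close> the canonical map \<open>X \<rightarrow> \<beta>X\<close> is an embedding.\<close>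

lemma embedding_map_sc_embed:
  assumes "tychonoff_space X"
  shows "embedding_map X (stone_cech X) (sc_embed X)"
proof -
  have "embedding_map X (sc_cube X) (\<lambda>x. \<lambda>h\<in>unit_maps X. h x)"
    using completely_regular_space_cube_embedding_explicit[of X] assms
    unfolding tychonoff_space_def sc_cube_def unit_maps_eq by blast
  then have "embedding_map X (sc_cube X) (sc_embed X)"
    by (rule embedding_map_eq) (simp add: sc_embed_def)
  then show ?thesis
    unfolding embedding_map_def stone_cech_def subtopology_subtopology
    by (simp add: Int_absorb1 closure_of_subset sc_embed_subset)
qed

lemma homeomorphic_map_sc_embed:
  assumes "compact_space K" "Hausdorff_space K"
  shows "homeomorphic_map K (stone_cech K) (sc_embed K)"
proof -
  have "tychonoff_space K"
    using assms by (simp add: tychonoff_space_def compact_Hausdorff_or_regular_imp_normal_space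
        normal_imp_completely_regular_space)
  then have emb: "embedding_map K (stone_cech K) (sc_embed K)"
    by (rule embedding_map_sc_embed)
  have "compactin (stone_cech K) (sc_embed K ` topspace K)"
    using assms(1) continuous_map_sc_embed compact_space_def image_compactin by blast
  then have "closedin (stone_cech K) (sc_embed K ` topspace K)"
    by (simp add: Hausdorff_space_stone_cech compactin_imp_closedin)
  then have "sc_embed K ` topspace K = topspace (stone_cech K)"
    using sc_embed_dense[of K] by (simp add: closure_of_closedin)
  then show ?thesis
    using emb by (simp add: embedding_map_def)
qed

lemma ex1_stone_cech_map:
  assumes f: "continuous_map X Y f"
  shows "\<exists>!F. F \<in> cmaps (stone_cech X) (stone_cech Y) \<and>
              (\<forall>x\<in>topspace X. F (sc_embed X x) = sc_embed Y (f x))"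
proof (rule ex_ex1I)
  define F0 where "F0 = (\<lambda>(p :: ('a \<Rightarrow> real) \<Rightarrow> real). \<lambda>h\<in>unit_maps Y. p (restrict (h \<circ> f) (topspace X)))"
  have fim: "f x \<in> topspace Y" if "x \<in> topspace X" for x
    using continuous_map_image_subset_topspace[OF f] that by blast
  have pull: "restrict (h \<circ> f) (topspace X) \<in> unit_maps X" if "h \<in> unit_maps Y" for h
  proof -
    have "continuous_map X (top_of_set {0..1}) (h \<circ> f)"
      using that f continuous_map_compose by (auto simp: cmaps_def)
    then have "continuous_map X (top_of_set {0..1}) (restrict (h \<circ> f) (topspace X))"
      by (rule continuous_map_eq) simp
    then show ?thesis
      by (simp add: cmaps_def)
  qed
  have F0: "continuous_map (sc_cube X) (sc_cube Y) F0"
    unfolding sc_cube_def continuous_map_componentwise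
  proof (intro conjI ballI)
    fix h assume h: "h \<in> unit_maps Y"
    show "continuous_map (product_topology (\<lambda>_. top_of_set {0..1}) (unit_maps X))
        (top_of_set {0..1}) (\<lambda>p. F0 p h)"
      using continuous_map_product_coordinates[OF pull[OF h], where T = "\<lambda>_. top_of_set {0..1}"]
      unfolding F0_def restrict_apply'[OF h] .
  qed (auto simp: F0_def)
  have F0_ext: "F0 (sc_embed X x) = sc_embed Y (f x)" if "x \<in> topspace X" for x
  proof (rule ext)
    fix h
    show "F0 (sc_embed X x) h = sc_embed Y (f x) h"
      using that fim[OF that] pull[of h] by (cases "h \<in> unit_maps Y") (simp_all add: F0_def sc_embed_def)
  qed
  have "F0 ` (sc_cube X closure_of (sc_embed X ` topspace X)) \<subseteq>
      sc_cube Y closure_of (F0 ` (sc_embed X ` topspace X))"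
    using F0 sc_embed_subset by (simp add: continuous_map_image_closure_subset)
  also have "\<dots> \<subseteq> sc_cube Y closure_of (sc_embed Y ` topspace Y)"
    using F0_ext fim by (intro closure_of_mono) auto
  finally have "continuous_map (stone_cech X) (stone_cech Y) F0"
    unfolding stone_cech_def continuous_map_in_subtopology
    using F0 by (auto simp: continuous_map_from_subtopology)
  then have "continuous_map (stone_cech X) (stone_cech Y) (restrict F0 (topspace (stone_cech X)))"
    by (rule continuous_map_eq) simp
  moreover have "sc_embed X x \<in> topspace (stone_cech X)" if "x \<in> topspace X" for x
    using subsetD[OF continuous_map_image_subset_topspace[OF continuous_map_sc_embed] imageI[OF that]] .
  ultimately show "\<exists>F. F \<in> cmaps (stone_cech X) (stone_cech Y) \<and>
      (\<forall>x\<in>topspace X. F (sc_embed X x) = sc_embed Y (f x))"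
    using F0_ext by (intro exI[of _ "restrict F0 (topspace (stone_cech X))"]) (simp add: cmaps_def)
next
  fix F G
  assume F: "F \<in> cmaps (stone_cech X) (stone_cech Y) \<and>
      (\<forall>x\<in>topspace X. F (sc_embed X x) = sc_embed Y (f x))"
    and G: "G \<in> cmaps (stone_cech X) (stone_cech Y) \<and>
      (\<forall>x\<in>topspace X. G (sc_embed X x) = sc_embed Y (f x))"
  have "F p = G p" if "p \<in> topspace (stone_cech X)" for p
  proof (rule forall_in_closure_of_eq[where X = "stone_cech X" and Y = "stone_cech Y"
        and S = "sc_embed X ` topspace X" and f = F and g = G])
    show "p \<in> stone_cech X closure_of (sc_embed X ` topspace X)"
      using that sc_embed_dense by blast
  qed (use F G Hausdorff_space_stone_cech in \<open>auto simp: cmaps_def\<close>)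
  then show "F = G"
    using F G by (intro extensionalityI[where A = "topspace (stone_cech X)"]) (auto simp: cmaps_def)
qed

end

theory Submission
  imports Defs
begin

text \<open>
  Everything reduces to compact Hausdorff spaces, because \<open>P\<^sub>\<tau>(X)\<close> and \<open>P\<close>-hat\<open>(X)\<close> are subspaces
  of \<open>P(\<beta>X)\<close> and both act on morphisms by restricting \<open>P(\<beta>f)\<close>.

  \<^item> \<open>P\<close> is a functor: image measures of regular measures under continuous maps are regular
    because continuous maps carry compact sets to compact sets, \<open>P(g)\<close> is continuous by the change
    of variables formula, and image measures compose. The assignment \<open>f \<mapsto> \<beta>f\<close> is functorial by
    uniqueness of continuous extensions. So all functor laws follow as soon as \<open>P(\<beta>f)\<close> is known
    to respect the two subspaces.

  \<^item> For \<open>P\<^sub>\<tau>\<close> it does: a Borel set containing \<open>Y\<close> has a Borel preimage containing \<open>X\<close>. For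
    \<open>P\<close>-hat the image of a Borel subset of \<open>X\<close> need not be Borel, so the inner measure is first
    approximated by compact sets, whose images are compact.

  \<^item> A regular measure on a compact Hausdorff space is determined by the integrals of continuous
    functions (Urysohn's lemma). Hence these integrals embed \<open>P(K)\<close> into a power of the real
    line, and all subspaces of \<open>P(K)\<close> are Tychonoff.

  \<^item> For compact \<open>K\<close> the image of \<open>K\<close> is all of \<open>\<beta>K\<close>, so both conditions on measures are vacuous,
    and functoriality of \<open>P\<close> turns the homeomorphism \<open>K \<cong> \<beta>K\<close> and its naturality into the
    corresponding facts about measures.
\<close>


section \<open>Borel sets and continuous maps\<close>

lemma space_borel_sigma [simp]: "space (borel_sigma K) = topspace K"
  by (simp add: borel_sigma_def space_measure_of_conv)

lemma sets_borel_sigma: "sets (borel_sigma K) = sigma_sets (topspace K) {U. openin K U}"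
  unfolding borel_sigma_def by (rule sets_measure_of) (auto dest: openin_subset)

lemma openin_borel_sigma: "openin K U \<Longrightarrow> U \<in> sets (borel_sigma K)"
  by (simp add: sets_borel_sigma)

lemma closedin_borel_sigma:
  assumes "closedin K C" shows "C \<in> sets (borel_sigma K)"
proof -
  have "topspace K - (topspace K - C) \<in> sigma_sets (topspace K) {U. openin K U}"
    using assms by (intro sigma_sets.Compl sigma_sets.Basic) (simp add: closedin_def)
  then show ?thesis
    using closedin_subset[OF assms] by (simp add: sets_borel_sigma double_diff)
qed

lemma continuous_map_measurable_borel_sigma:
  assumes "space M = topspace K" "sets M = sets (borel_sigma K)" "continuous_map K L g"
  shows "g \<in> measurable M (borel_sigma L)"
  unfolding borel_sigma_def[of L]
proof (rule measurable_measure_of)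
  show "g \<in> space M \<rightarrow> topspace L"
    using assms by (simp add: continuous_map_funspace)
  fix U assume "U \<in> {U. openin L U}"
  then have "openin K {x \<in> topspace K. g x \<in> U}"
    using assms(3) by (simp add: openin_continuous_map_preimage)
  moreover have "g -` U \<inter> space M = {x \<in> topspace K. g x \<in> U}"
    using assms(1) by auto
  ultimately show "g -` U \<inter> space M \<in> sets M"
    using assms(2) openin_borel_sigma by metis
qed (auto dest: openin_subset)

lemma continuous_map_borel_measurable:
  fixes \<phi> :: "'a \<Rightarrow> real"
  assumes "space M = topspace K" "sets M = sets (borel_sigma K)" "continuous_map K euclideanreal \<phi>"
  shows "\<phi> \<in> borel_measurable M"
proof -
  have "borel_sigma euclideanreal = (borel :: real measure)"
    by (simp add: borel_sigma_def borel_def)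
  then show ?thesis
    using continuous_map_measurable_borel_sigma[OF assms] by simp
qed


section \<open>The functor of regular probability measures\<close>

lemma prob_measuresD:
  assumes "M \<in> prob_measures K"
  shows "space M = topspace K" "sets M = sets (borel_sigma K)" "prob_space M"
    "regular_measure_on K M"
  using assms by (auto simp: prob_measures_def)

lemma prob_measures_inner_regular:
  assumes "M \<in> prob_measures K" "B \<in> sets M"
  shows "emeasure M B = (SUP C\<in>{C. compactin K C \<and> C \<subseteq> B}. emeasure M C)"
  using prob_measuresD(4)[OF assms(1)] assms(2) unfolding regular_measure_on_def by blast

lemma prob_measures_outer_regular:
  assumes "M \<in> prob_measures K" "B \<in> sets M"
  shows "emeasure M B = (INF U\<in>{U. openin K U \<and> B \<subseteq> U}. emeasure M U)"
  using prob_measuresD(4)[OF assms(1)] assms(2) unfolding regular_measure_on_def by blast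

lemma compactin_sets_prob_measures:
  assumes "M \<in> prob_measures K" "Hausdorff_space K" "compactin K C"
  shows "C \<in> sets M"
  using assms by (simp add: prob_measuresD(2) closedin_borel_sigma compactin_imp_closedin)

text \<open>
  On a Hausdorff space with a probability measure, outer regularity is inner regularity of the
  complements, since \<open>\<mu>(B) = 1 - \<mu>(K - B)\<close> and complements of compact sets are open.
\<close>

lemma inner_regular_imp_regular_measure_on:
  assumes K: "Hausdorff_space K" and sp: "space M = topspace K"
    and st: "sets M = sets (borel_sigma K)" and M: "prob_space M"
    and inner: "\<And>B. B \<in> sets M \<Longrightarrow>
      emeasure M B = (SUP C\<in>{C. compactin K C \<and> C \<subseteq> B}. emeasure M C)"
  shows "regular_measure_on K M"
  unfolding regular_measure_on_def
proof (intro ballI conjI)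
  interpret prob_space M by fact
  fix B assume B: "B \<in> sets M"
  show "emeasure M B = (SUP C\<in>{C. compactin K C \<and> C \<subseteq> B}. emeasure M C)"
    using B by (rule inner)
  show "emeasure M B = (INF U\<in>{U. openin K U \<and> B \<subseteq> U}. emeasure M U)"
  proof (rule antisym)
    show "emeasure M B \<le> (INF U\<in>{U. openin K U \<and> B \<subseteq> U}. emeasure M U)"
      by (rule INF_greatest) (auto intro!: emeasure_mono simp: st openin_borel_sigma)
    have compl: "emeasure M (space M - A) = 1 - emeasure M A" if "A \<in> sets M" for A
      using that by (simp add: emeasure_compl emeasure_space_1)
    have sub: "B \<subseteq> space M"
      using B by (rule sets.sets_into_space)
    let ?\<C> = "{C. compactin K C \<and> C \<subseteq> space M - B}"
    have "(INF U\<in>{U. openin K U \<and> B \<subseteq> U}. emeasure M U) \<le> (INF C\<in>?\<C>. 1 - emeasure M C)"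
    proof (rule INF_mono)
      fix C assume C: "C \<in> ?\<C>"
      then have cl: "closedin K C"
        using K by (simp add: compactin_imp_closedin)
      then have "1 - emeasure M C = emeasure M (space M - C)"
        by (simp add: compl st closedin_borel_sigma)
      moreover have "openin K (space M - C)" "B \<subseteq> space M - C"
        using cl C sub by (auto simp: sp)
      ultimately show "\<exists>U\<in>{U. openin K U \<and> B \<subseteq> U}. emeasure M U \<le> 1 - emeasure M C"
        by (intro bexI[of _ "space M - C"]) auto
    qed
    also have "\<dots> = 1 - (SUP C\<in>?\<C>. emeasure M C)"
      by (rule ennreal_SUP_const_minus) (auto intro: exI[of _ "{}"])
    also have "(SUP C\<in>?\<C>. emeasure M C) = emeasure M (space M - B)"
      using B by (intro inner[symmetric]) auto
    also have "1 - emeasure M (space M - B) = emeasure M B"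
      using compl[of "space M - B"] B sub by (simp add: double_diff)
    finally show "(INF U\<in>{U. openin K U \<and> B \<subseteq> U}. emeasure M U) \<le> emeasure M B" .
  qed
qed

text \<open>
  A compact subset \<open>C\<close> of \<open>g\<^sup>-\<^sup>1(B)\<close> has compact image \<open>g(C) \<subseteq> B\<close>, and \<open>C \<subseteq> g\<^sup>-\<^sup>1(g(C))\<close>; so inner
  regularity passes to image measures.
\<close>

lemma distr_in_prob_measures:
  assumes L: "Hausdorff_space L" and g: "continuous_map K L g" and M: "M \<in> prob_measures K"
  shows "distr M (borel_sigma L) g \<in> prob_measures L"
proof -
  let ?N = "distr M (borel_sigma L) g"
  note MD = prob_measuresD[OF M]
  have meas: "g \<in> measurable M (borel_sigma L)"
    using MD(1,2) g by (rule continuous_map_measurable_borel_sigma)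
  have N: "prob_space ?N"
    using MD(3) meas by (rule prob_space.prob_space_distr)
  have "regular_measure_on L ?N"
  proof (rule inner_regular_imp_regular_measure_on[OF L _ _ N])
    fix B assume "B \<in> sets ?N"
    then have B: "B \<in> sets (borel_sigma L)"
      by simp
    show "emeasure ?N B = (SUP D\<in>{D. compactin L D \<and> D \<subseteq> B}. emeasure ?N D)"
    proof (rule antisym)
      have "g -` B \<inter> space M \<in> sets M"
        using meas B by (rule measurable_sets)
      then have "emeasure ?N B =
          (SUP C\<in>{C. compactin K C \<and> C \<subseteq> g -` B \<inter> space M}. emeasure M C)"
        using meas B M by (simp add: emeasure_distr prob_measures_inner_regular)
      also have "\<dots> \<le> (SUP D\<in>{D. compactin L D \<and> D \<subseteq> B}. emeasure ?N D)"
      proof (rule SUP_mono)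
        fix C assume C: "C \<in> {C. compactin K C \<and> C \<subseteq> g -` B \<inter> space M}"
        then have gC: "compactin L (g ` C)" "g ` C \<subseteq> B"
          using g image_compactin by auto
        have "g ` C \<in> sets (borel_sigma L)"
          using L gC(1) by (simp add: closedin_borel_sigma compactin_imp_closedin)
        moreover from this have "g -` (g ` C) \<inter> space M \<in> sets M"
          using meas by (rule measurable_sets[rotated])
        ultimately have "emeasure M C \<le> emeasure ?N (g ` C)"
          using meas C by (subst emeasure_distr) (auto intro!: emeasure_mono)
        with gC show "\<exists>D\<in>{D. compactin L D \<and> D \<subseteq> B}. emeasure M C \<le> emeasure ?N D"
          by blast
      qed
      finally show "emeasure ?N B \<le> (SUP D\<in>{D. compactin L D \<and> D \<subseteq> B}. emeasure ?N D)" .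
      show "(SUP D\<in>{D. compactin L D \<and> D \<subseteq> B}. emeasure ?N D) \<le> emeasure ?N B"
        using B by (intro SUP_least emeasure_mono) auto
    qed
  qed simp_all
  then show ?thesis
    using N by (simp add: prob_measures_def)
qed

lemma P_map_in_prob_measures:
  assumes "Hausdorff_space L" "continuous_map K L g" "M \<in> prob_measures K"
  shows "P_map K L g M \<in> prob_measures L"
  using assms by (simp add: P_map_def distr_in_prob_measures)

lemma P_map_cong:
  assumes "\<And>x. x \<in> topspace K \<Longrightarrow> g x = h x"
  shows "P_map K L g = P_map K L h"
  unfolding P_map_def
  by (intro restrict_ext distr_cong) (auto simp: prob_measuresD assms)

lemma P_map_ident:
  assumes "\<And>x. x \<in> topspace K \<Longrightarrow> g x = x" "M \<in> prob_measures K"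
  shows "P_map K K g M = M"
proof -
  have "distr M (borel_sigma K) g = distr M M (\<lambda>x. x)"
    using assms by (intro distr_cong) (auto simp: prob_measuresD)
  then show ?thesis
    using assms(2) by (simp add: P_map_def)
qed

lemma P_map_comp:
  assumes L: "Hausdorff_space L" and g: "continuous_map K L g" and h: "continuous_map L N h"
    and M: "M \<in> prob_measures K"
  shows "P_map L N h (P_map K L g M) = P_map K N (h \<circ> g) M"
proof -
  have "h \<in> measurable (borel_sigma L) (borel_sigma N)"
    using h by (intro continuous_map_measurable_borel_sigma) auto
  moreover have "g \<in> measurable M (borel_sigma L)"
    using prob_measuresD(1,2)[OF M] g by (rule continuous_map_measurable_borel_sigma)
  ultimately show ?thesis
    using M distr_in_prob_measures[OF L g M] by (simp add: P_map_def distr_distr)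
qed

lemma openin_P_space_integral:
  assumes "continuous_map K euclideanreal \<phi>" "open U"
  shows "openin (P_space K) {M \<in> prob_measures K. (\<integral>x. \<phi> x \<partial>M) \<in> U}"
  unfolding P_space_def using assms by (intro topology_generated_by_Basis) blast

lemma continuous_map_into_P_space:
  assumes "e \<in> topspace T \<rightarrow> prob_measures K"
    and "\<And>\<phi>. continuous_map K euclideanreal \<phi> \<Longrightarrow>
      continuous_map T euclideanreal (\<lambda>t. \<integral>x. \<phi> x \<partial>(e t))"
  shows "continuous_map T (P_space K) e"
  unfolding P_space_def
proof (rule continuous_on_generated_topo)
  fix V assume "V \<in> {{M \<in> prob_measures K. (\<integral>x. \<phi> x \<partial>M) \<in> U} | \<phi> U.
      continuous_map K euclideanreal \<phi> \<and> open U}"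
  then obtain \<phi> U where \<phi>: "continuous_map K euclideanreal \<phi>" and U: "open U"
    and V: "V = {M \<in> prob_measures K. (\<integral>x. \<phi> x \<partial>M) \<in> U}"
    by blast
  have "openin T {t \<in> topspace T. (\<integral>x. \<phi> x \<partial>(e t)) \<in> U}"
    using assms(2)[OF \<phi>] U by (simp add: openin_continuous_map_preimage)
  moreover have "e -` V \<inter> topspace T = {t \<in> topspace T. (\<integral>x. \<phi> x \<partial>(e t)) \<in> U}"
    using assms(1) V by auto
  ultimately show "openin T (e -` V \<inter> topspace T)"
    by simp
next
  show "e ` topspace T \<subseteq> \<Union>{{M \<in> prob_measures K. (\<integral>x. \<phi> x \<partial>M) \<in> U} | \<phi> U.
      continuous_map K euclideanreal \<phi> \<and> open U}"
    using assms(1) topspace_P_space[of K]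
    unfolding P_space_def topology_generated_by_topspace by auto
qed

lemma continuous_map_integral:
  assumes "continuous_map K euclideanreal \<phi>"
  shows "continuous_map (P_space K) euclideanreal (\<lambda>M. \<integral>x. \<phi> x \<partial>M)"
  unfolding continuous_map_def
  using openin_P_space_integral[OF assms] by (simp add: topspace_P_space)

lemma continuous_map_P_map:
  assumes L: "Hausdorff_space L" and g: "continuous_map K L g"
  shows "continuous_map (P_space K) (P_space L) (P_map K L g)"
proof (rule continuous_map_into_P_space)
  show "P_map K L g \<in> topspace (P_space K) \<rightarrow> prob_measures L"
    using assms by (simp add: topspace_P_space P_map_in_prob_measures)
next
  fix \<phi> :: "_ \<Rightarrow> real"
  assume \<phi>: "continuous_map L euclideanreal \<phi>"
  have "continuous_map K euclideanreal (\<phi> \<circ> g)"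
    using g \<phi> by (rule continuous_map_compose)
  then have "continuous_map (P_space K) euclideanreal (\<lambda>M. \<integral>x. (\<phi> \<circ> g) x \<partial>M)"
    by (rule continuous_map_integral)
  then show "continuous_map (P_space K) euclideanreal (\<lambda>M. \<integral>x. \<phi> x \<partial>(P_map K L g M))"
  proof (rule continuous_map_eq)
    fix M assume "M \<in> topspace (P_space K)"
    then have M: "M \<in> prob_measures K"
      by (simp add: topspace_P_space)
    have "g \<in> measurable M (borel_sigma L)"
      using prob_measuresD(1,2)[OF M] g by (rule continuous_map_measurable_borel_sigma)
    moreover have "\<phi> \<in> borel_measurable (borel_sigma L)"
      using \<phi> by (intro continuous_map_borel_measurable) auto
    ultimately show "(\<integral>x. (\<phi> \<circ> g) x \<partial>M) = (\<integral>x. \<phi> x \<partial>(P_map K L g M))"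
      using M by (simp add: P_map_def integral_distr)
  qed
qed

lemma homeomorphic_map_P_map:
  assumes "Hausdorff_space K" "Hausdorff_space L" "homeomorphic_map K L g"
  shows "homeomorphic_map (P_space K) (P_space L) (P_map K L g)"
proof -
  obtain h where "homeomorphic_maps K L g h"
    using assms(3) homeomorphic_map_maps by blast
  then have g: "continuous_map K L g" and h: "continuous_map L K h"
    and hg: "\<And>x. x \<in> topspace K \<Longrightarrow> (h \<circ> g) x = x"
    and gh: "\<And>y. y \<in> topspace L \<Longrightarrow> (g \<circ> h) y = y"
    by (auto simp: homeomorphic_maps_def)
  have "homeomorphic_maps (P_space K) (P_space L) (P_map K L g) (P_map L K h)"
    unfolding homeomorphic_maps_def topspace_P_space
  proof (intro conjI ballI)
    show "P_map L K h (P_map K L g M) = M" if "M \<in> prob_measures K" for M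
      using P_map_comp[OF assms(2) g h that] P_map_ident[OF hg that] by simp
    show "P_map K L g (P_map L K h N) = N" if "N \<in> prob_measures L" for N
      using P_map_comp[OF assms(1) h g that] P_map_ident[OF gh that] by simp
  qed (use assms g h in \<open>simp_all add: continuous_map_P_map\<close>)
  then show ?thesis
    using homeomorphic_map_maps by blast
qed


section \<open>Spaces of measures are Tychonoff\<close>

text \<open>
  If \<open>U\<close> is an open neighbourhood of the compact set \<open>C\<close>, a Urysohn function \<open>\<phi>\<close> with
  \<open>1\<^sub>C \<le> \<phi> \<le> 1\<^sub>U\<close> gives \<open>\<mu>(C) \<le> \<integral>\<phi> d\<mu> = \<integral>\<phi> d\<nu> \<le> \<nu>(U)\<close>. Outer regularity of \<open>\<nu>\<close> then yields
  \<open>\<mu>(C) \<le> \<nu>(C)\<close>.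
\<close>

lemma emeasure_compactin_le_if_integrals_eq:
  assumes K: "compact_space K" "Hausdorff_space K"
    and M: "M \<in> prob_measures K" and N: "N \<in> prob_measures K"
    and eq: "\<And>\<phi>. continuous_map K euclideanreal \<phi> \<Longrightarrow> (\<integral>x. \<phi> x \<partial>M) = (\<integral>x. \<phi> x \<partial>N)"
    and C: "compactin K C"
  shows "emeasure M C \<le> emeasure N C"
proof -
  note MD = prob_measuresD[OF M] and ND = prob_measuresD[OF N]
  interpret M: prob_space M by (rule MD)
  interpret N: prob_space N by (rule ND)
  have clC: "closedin K C"
    using K C by (simp add: compactin_imp_closedin)
  have CM: "C \<in> sets M" and CN: "C \<in> sets N"
    using compactin_sets_prob_measures M N K C by blast+
  have "emeasure M C \<le> emeasure N U" if U: "openin K U" "C \<subseteq> U" for U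
  proof -
    have UN: "U \<in> sets N"
      using U by (simp add: ND openin_borel_sigma)
    have "normal_space K"
      using K by (simp add: compact_Hausdorff_or_regular_imp_normal_space)
    moreover have "closedin K (topspace K - U)" "disjnt (topspace K - U) C"
      using U by (auto simp: disjnt_def)
    ultimately obtain \<phi> where \<phi>: "continuous_map K (top_of_set {0..1::real}) \<phi>"
      and \<phi>0: "\<phi> ` (topspace K - U) \<subseteq> {0}" and \<phi>1: "\<phi> ` C \<subseteq> {1}"
      using Urysohn_lemma[of K "topspace K - U" C 0 1] clC by auto
    have cont: "continuous_map K euclideanreal \<phi>" and rng: "\<And>x. x \<in> topspace K \<Longrightarrow> \<phi> x \<in> {0..1}"
      using \<phi> by (auto simp: continuous_map_in_subtopology)
    have int: "integrable M \<phi>" "integrable N \<phi>"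
      using rng continuous_map_borel_measurable[OF MD(1,2) cont]
        continuous_map_borel_measurable[OF ND(1,2) cont]
      by (auto intro!: M.integrable_const_bound[of \<phi> 1] N.integrable_const_bound[of \<phi> 1]
          AE_I2 simp: MD ND)
    have ind: "integrable M (indicat_real C)" "integrable N (indicat_real U)"
      using CM UN by (auto intro!: integrable_real_indicator
          simp: M.emeasure_eq_measure N.emeasure_eq_measure)
    have "measure M C = (\<integral>x. indicator C x \<partial>M)"
      using CM by simp
    also have "\<dots> \<le> (\<integral>x. \<phi> x \<partial>M)"
      using rng \<phi>1 by (intro integral_mono ind int) (auto simp: MD indicator_def)
    also have "\<dots> = (\<integral>x. \<phi> x \<partial>N)"
      using cont by (rule eq)
    also have "\<dots> \<le> (\<integral>x. indicator U x \<partial>N)"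
      using rng \<phi>0 by (intro integral_mono ind int) (auto simp: ND indicator_def)
    also have "\<dots> = measure N U"
      using UN by simp
    finally show ?thesis
      by (simp add: M.emeasure_eq_measure N.emeasure_eq_measure)
  qed
  then show ?thesis
    unfolding prob_measures_outer_regular[OF N CN] by (auto intro: INF_greatest)
qed

lemma prob_measures_eqI_integral:
  assumes K: "compact_space K" "Hausdorff_space K"
    and M: "M \<in> prob_measures K" and N: "N \<in> prob_measures K"
    and eq: "\<And>\<phi>. continuous_map K euclideanreal \<phi> \<Longrightarrow> (\<integral>x. \<phi> x \<partial>M) = (\<integral>x. \<phi> x \<partial>N)"
  shows "M = N"
proof (rule measure_eqI)
  show sets_eq: "sets M = sets N"
    using M N by (simp add: prob_measuresD)
  fix B assume B: "B \<in> sets M"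
  have "emeasure M C = emeasure N C" if "compactin K C" for C
    using emeasure_compactin_le_if_integrals_eq[OF K M N eq that]
      emeasure_compactin_le_if_integrals_eq[OF K N M eq[symmetric] that] by simp
  then have "(SUP C\<in>{C. compactin K C \<and> C \<subseteq> B}. emeasure M C) =
      (SUP C\<in>{C. compactin K C \<and> C \<subseteq> B}. emeasure N C)"
    by (intro SUP_cong) auto
  then show "emeasure M B = emeasure N B"
    using prob_measures_inner_regular[OF M B] prob_measures_inner_regular[OF N] B sets_eq by simp
qed

text \<open>
  The topology of \<open>P(K)\<close> is initial for the integrals of continuous functions, which separate
  points; so they form an embedding into a power of the real line.
\<close>

lemma tychonoff_space_P_space:
  assumes K: "compact_space K" "Hausdorff_space K"
  shows "tychonoff_space (P_space K)"
proof -
  define I where "I = {\<phi>. continuous_map K euclideanreal \<phi>}"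
  define R where "R = product_topology (\<lambda>_. euclideanreal) I"
  define e where "e = (\<lambda>M. \<lambda>\<phi>\<in>I. \<integral>x. \<phi> x \<partial>M)"
  define S where "S = subtopology R (e ` prob_measures K)"
  have inj: "inj_on e (prob_measures K)"
  proof (rule inj_onI)
    fix M N assume M: "M \<in> prob_measures K" and N: "N \<in> prob_measures K" and "e M = e N"
    then have "e M \<phi> = e N \<phi>" for \<phi>
      by simp
    then show "M = N"
      by (intro prob_measures_eqI_integral[OF K M N])
        (metis (full_types) I_def e_def mem_Collect_eq restrict_apply')
  qed
  have e: "continuous_map (P_space K) S e"
    unfolding S_def continuous_map_in_subtopology
  proof
    show "continuous_map (P_space K) R e"
      unfolding R_def continuous_map_componentwise
      by (auto simp: e_def I_def continuous_map_integral)
  qed (auto simp: topspace_P_space)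
  have topS: "topspace S = e ` prob_measures K"
    using continuous_map_image_subset_topspace[OF e]
    by (auto simp: S_def topspace_P_space)
  let ?d = "inv_into (prob_measures K) e"
  have d: "continuous_map S (P_space K) ?d"
  proof (rule continuous_map_into_P_space)
    show "?d \<in> topspace S \<rightarrow> prob_measures K"
      by (auto simp: topS inv_into_into)
    fix \<phi> :: "'a \<Rightarrow> real" assume \<phi>: "continuous_map K euclideanreal \<phi>"
    have "continuous_map S euclideanreal (\<lambda>p. p \<phi>)"
      unfolding S_def R_def
      by (intro continuous_map_from_subtopology continuous_map_product_projection)
        (simp add: I_def \<phi>)
    then show "continuous_map S euclideanreal (\<lambda>p. \<integral>x. \<phi> x \<partial>(?d p))"
    proof (rule continuous_map_eq)
      fix p assume "p \<in> topspace S"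
      then have "e (?d p) = p"
        by (simp add: topS f_inv_into_f)
      then have "p \<phi> = e (?d p) \<phi>"
        by simp
      then show "p \<phi> = (\<integral>x. \<phi> x \<partial>(?d p))"
        using \<phi> by (simp add: e_def I_def)
    qed
  qed
  have "homeomorphic_maps (P_space K) S e ?d"
    unfolding homeomorphic_maps_def topspace_P_space topS
    using e d inj by (auto simp: f_inv_into_f)
  then have "P_space K homeomorphic_space S"
    using homeomorphic_space_def by blast
  moreover have "completely_regular_space S" "Hausdorff_space S"
    by (auto simp: S_def R_def completely_regular_space_product_topology
        metrizable_imp_completely_regular_space metrizable_space_euclidean Hausdorff_space_product_topology
        intro!: completely_regular_space_subtopology Hausdorff_space_subtopology)
  ultimately show ?thesis
    using homeomorphic_completely_regular_space homeomorphic_Hausdorff_space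
    by (auto simp: tychonoff_space_def)
qed

lemma tychonoff_space_subtopology:
  "tychonoff_space X \<Longrightarrow> tychonoff_space (subtopology X S)"
  by (simp add: tychonoff_space_def completely_regular_space_subtopology
      Hausdorff_space_subtopology)


section \<open>Outer and inner measure of the image of a set\<close>

text \<open>
  Preimages of measurable sets covering \<open>B\<close> cover \<open>A\<close>, so they have full measure. The inclusion
  \<open>B \<subseteq> space N\<close> provides a measurable cover of \<open>B\<close> at all; without one the infimum would be \<open>\<infinity>\<close>.
\<close>

lemma outer_measure_of_distr_eq_1:
  assumes M: "prob_space M" and g: "g \<in> measurable M N"
    and A: "A \<subseteq> space M" "outer_measure_of M A = 1"
    and B: "g ` A \<subseteq> B" "B \<subseteq> space N"
  shows "outer_measure_of (distr M N g) B = 1"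
proof (rule antisym)
  interpret N: prob_space "distr M N g"
    using M g by (rule prob_space.prob_space_distr)
  have "outer_measure_of (distr M N g) B \<le> emeasure (distr M N g) (space N)"
    using B(2) unfolding outer_measure_of_def by (intro INF_lower) auto
  then show "outer_measure_of (distr M N g) B \<le> 1"
    using N.emeasure_space_1 by simp
  show "1 \<le> outer_measure_of (distr M N g) B"
    unfolding outer_measure_of_def
  proof (rule INF_greatest)
    fix D assume D: "D \<in> {D \<in> sets (distr M N g). B \<subseteq> D}"
    then have "A \<subseteq> g -` D \<inter> space M" "g -` D \<inter> space M \<in> sets M"
      using A(1) B(1) g by (auto intro: measurable_sets)
    then have "outer_measure_of M A \<le> emeasure M (g -` D \<inter> space M)"
      unfolding outer_measure_of_def by (intro INF_lower) auto
    then show "1 \<le> emeasure (distr M N g) D"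
      using A(2) D g by (simp add: emeasure_distr)
  qed
qed

text \<open>
  Regularity replaces measurable subsets by compact ones. Compact sets, unlike Borel sets, are
  preserved by taking images, and this is what lets the inner measure pass to image measures.
\<close>

lemma inner_measure_of_prob_measures:
  assumes M: "M \<in> prob_measures K" and K: "Hausdorff_space K"
  shows "inner_measure_of M A = (SUP C\<in>{C. compactin K C \<and> C \<subseteq> A}. emeasure M C)"
proof (rule antisym)
  have "emeasure M B \<le> (SUP C\<in>{C. compactin K C \<and> C \<subseteq> A}. emeasure M C)"
    if "B \<in> sets M" "B \<subseteq> A" for B
    unfolding prob_measures_inner_regular[OF M that(1)] using that(2)
    by (intro SUP_subset_mono) auto
  then show "inner_measure_of M A \<le> (SUP C\<in>{C. compactin K C \<and> C \<subseteq> A}. emeasure M C)"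
    unfolding inner_measure_of_def by (auto intro: SUP_least)
  show "(SUP C\<in>{C. compactin K C \<and> C \<subseteq> A}. emeasure M C) \<le> inner_measure_of M A"
    unfolding inner_measure_of_def using compactin_sets_prob_measures[OF M K]
    by (intro SUP_subset_mono) auto
qed

lemma inner_measure_of_distr_eq_1:
  assumes K: "Hausdorff_space K" and L: "Hausdorff_space L" and g: "continuous_map K L g"
    and M: "M \<in> prob_measures K" and A: "inner_measure_of M A = 1" and B: "g ` A \<subseteq> B"
  shows "inner_measure_of (distr M (borel_sigma L) g) B = 1"
proof -
  let ?N = "distr M (borel_sigma L) g"
  have N: "?N \<in> prob_measures L"
    using L g M by (rule distr_in_prob_measures)
  interpret N: prob_space ?N
    using N by (rule prob_measuresD)
  have meas: "g \<in> measurable M (borel_sigma L)"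
    using prob_measuresD(1,2)[OF M] g by (rule continuous_map_measurable_borel_sigma)
  show ?thesis
  proof (rule antisym)
    show "inner_measure_of ?N B \<le> 1"
      unfolding inner_measure_of_def by (intro SUP_least N.emeasure_le_1)
    have "1 = (SUP C\<in>{C. compactin K C \<and> C \<subseteq> A}. emeasure M C)"
      using inner_measure_of_prob_measures[OF M K] A by simp
    also have "\<dots> \<le> inner_measure_of ?N B"
      unfolding inner_measure_of_prob_measures[OF N L]
    proof (rule SUP_mono)
      fix C assume C: "C \<in> {C. compactin K C \<and> C \<subseteq> A}"
      then have gC: "compactin L (g ` C)" "g ` C \<subseteq> B"
        using g B image_compactin by blast+
      have "g ` C \<in> sets ?N"
        using N L gC(1) by (rule compactin_sets_prob_measures)
      moreover from this have "g -` (g ` C) \<inter> space M \<in> sets M"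
        using meas by (auto intro: measurable_sets)
      moreover have "C \<subseteq> space M"
        using C by (simp add: prob_measuresD(1)[OF M] compactin_subset_topspace)
      ultimately have "emeasure M C \<le> emeasure ?N (g ` C)"
        using meas by (subst emeasure_distr) (auto intro!: emeasure_mono)
      with gC show "\<exists>D\<in>{D. compactin L D \<and> D \<subseteq> B}. emeasure M C \<le> emeasure ?N D"
        by blast
    qed
    finally show "1 \<le> inner_measure_of ?N B" .
  qed
qed


section \<open>Functoriality of the Stone-Cech extension\<close>

lemma sc_embed_in_stone_cech: "x \<in> topspace X \<Longrightarrow> sc_embed X x \<in> topspace (stone_cech X)"
  using continuous_map_sc_embed by (metis continuous_map_funspace funcset_mem)

lemma sc_embed_image_subset: "sc_embed X ` topspace X \<subseteq> topspace (stone_cech X)"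
  by (auto intro: sc_embed_in_stone_cech)

lemma stone_cech_map_props:
  assumes "continuous_map X Y f"
  shows "stone_cech_map X Y f \<in> cmaps (stone_cech X) (stone_cech Y)"
    and "\<And>x. x \<in> topspace X \<Longrightarrow> stone_cech_map X Y f (sc_embed X x) = sc_embed Y (f x)"
  using theI'[OF ex1_stone_cech_map[OF assms]] unfolding stone_cech_map_def by blast+

lemma continuous_map_stone_cech_map:
  "continuous_map X Y f \<Longrightarrow> continuous_map (stone_cech X) (stone_cech Y) (stone_cech_map X Y f)"
  using stone_cech_map_props(1) by (auto simp: cmaps_def)

lemma stone_cech_map_unique:
  assumes "continuous_map X Y f" "F \<in> cmaps (stone_cech X) (stone_cech Y)"
    and "\<And>x. x \<in> topspace X \<Longrightarrow> F (sc_embed X x) = sc_embed Y (f x)"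
  shows "stone_cech_map X Y f = F"
  unfolding stone_cech_map_def
  by (rule the1_equality[OF ex1_stone_cech_map[OF assms(1)]]) (use assms in blast)

lemma stone_cech_map_ident:
  "stone_cech_map X X (restrict id (topspace X)) = restrict id (topspace (stone_cech X))"
proof (rule stone_cech_map_unique)
  show "continuous_map X X (restrict id (topspace X))"
    by (rule continuous_map_eq[OF continuous_map_id]) simp
  have "continuous_map (stone_cech X) (stone_cech X) (restrict id (topspace (stone_cech X)))"
    by (rule continuous_map_eq[OF continuous_map_id]) simp
  then show "restrict id (topspace (stone_cech X)) \<in> cmaps (stone_cech X) (stone_cech X)"
    by (simp add: cmaps_def)
qed (simp add: sc_embed_in_stone_cech)

lemma continuous_map_compose_restricted:
  assumes "continuous_map X Y f" "continuous_map Y Z g"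
  shows "continuous_map X Z (compose (topspace X) g f)"
  by (rule continuous_map_eq[OF continuous_map_compose[OF assms]]) (simp add: compose_def)

text \<open>
  Both sides are continuous on \<open>\<beta>X\<close> and agree with \<open>g \<circ> f\<close> on the dense image of \<open>X\<close>.
\<close>

lemma stone_cech_map_compose:
  assumes f: "continuous_map X Y f" and g: "continuous_map Y Z g"
  shows "stone_cech_map X Z (compose (topspace X) g f) =
    compose (topspace (stone_cech X)) (stone_cech_map Y Z g) (stone_cech_map X Y f)"
proof (rule stone_cech_map_unique)
  show "continuous_map X Z (compose (topspace X) g f)"
    using f g by (rule continuous_map_compose_restricted)
  show "compose (topspace (stone_cech X)) (stone_cech_map Y Z g) (stone_cech_map X Y f)
      \<in> cmaps (stone_cech X) (stone_cech Z)"
    using continuous_map_compose_restricted[OF continuous_map_stone_cech_map[OF f]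
        continuous_map_stone_cech_map[OF g]]
    by (simp add: cmaps_def compose_extensional)
  fix x assume x: "x \<in> topspace X"
  then have "f x \<in> topspace Y"
    using f by (metis continuous_map_funspace funcset_mem)
  with x show "compose (topspace (stone_cech X)) (stone_cech_map Y Z g) (stone_cech_map X Y f)
      (sc_embed X x) = sc_embed Z (compose (topspace X) g f x)"
    using f g by (simp add: compose_eq sc_embed_in_stone_cech stone_cech_map_props)
qed

lemma P_map_stone_cech_ident:
  assumes "M \<in> prob_measures (stone_cech X)"
  shows "P_map (stone_cech X) (stone_cech X)
    (stone_cech_map X X (restrict id (topspace X))) M = M"
  using assms by (intro P_map_ident) (simp_all add: stone_cech_map_ident)

lemma P_map_stone_cech_compose:
  assumes f: "continuous_map X Y f" and g: "continuous_map Y Z g"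
    and M: "M \<in> prob_measures (stone_cech X)"
  shows "P_map (stone_cech X) (stone_cech Z) (stone_cech_map X Z (compose (topspace X) g f)) M =
    P_map (stone_cech Y) (stone_cech Z) (stone_cech_map Y Z g)
      (P_map (stone_cech X) (stone_cech Y) (stone_cech_map X Y f) M)"
proof -
  have "P_map (stone_cech X) (stone_cech Z) (stone_cech_map X Z (compose (topspace X) g f)) =
      P_map (stone_cech X) (stone_cech Z) (stone_cech_map Y Z g \<circ> stone_cech_map X Y f)"
    by (rule P_map_cong) (simp add: stone_cech_map_compose[OF f g] compose_eq)
  then show ?thesis
    using P_map_comp[OF Hausdorff_space_stone_cech continuous_map_stone_cech_map[OF f]
        continuous_map_stone_cech_map[OF g] M] by simp
qed

text \<open>
  The embedding \<open>K \<rightarrow> \<beta>K\<close> is natural in \<open>K\<close>, since \<open>\<beta>f\<close> extends \<open>f\<close>; applying the functor \<open>P\<close> to the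
  naturality square gives the same for measures.
\<close>

lemma P_map_stone_cech_natural:
  assumes f: "continuous_map K L f" and L: "Hausdorff_space L" and M: "M \<in> prob_measures K"
  shows "P_map (stone_cech K) (stone_cech L) (stone_cech_map K L f)
      (P_map K (stone_cech K) (sc_embed K) M) =
    P_map L (stone_cech L) (sc_embed L) (P_map K L f M)"
proof -
  have "P_map (stone_cech K) (stone_cech L) (stone_cech_map K L f)
      (P_map K (stone_cech K) (sc_embed K) M) =
      P_map K (stone_cech L) (stone_cech_map K L f \<circ> sc_embed K) M"
    by (rule P_map_comp[OF Hausdorff_space_stone_cech continuous_map_sc_embed
          continuous_map_stone_cech_map[OF f] M])
  also have "P_map K (stone_cech L) (stone_cech_map K L f \<circ> sc_embed K) =
      P_map K (stone_cech L) (sc_embed L \<circ> f)"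
    by (rule P_map_cong) (simp add: stone_cech_map_props(2)[OF f])
  also have "P_map K (stone_cech L) (sc_embed L \<circ> f) M =
      P_map L (stone_cech L) (sc_embed L) (P_map K L f M)"
    by (rule P_map_comp[OF L f continuous_map_sc_embed M, symmetric])
  finally show ?thesis .
qed


section \<open>The two subfunctors\<close>

lemma topspace_P_tau: "topspace (P_tau X) =
    {M \<in> prob_measures (stone_cech X). outer_measure_of M (sc_embed X ` topspace X) = 1}"
  by (auto simp: P_tau_def topspace_P_space)

lemma topspace_P_hat: "topspace (P_hat X) =
    {M \<in> prob_measures (stone_cech X). inner_measure_of M (sc_embed X ` topspace X) = 1}"
  by (auto simp: P_hat_def topspace_P_space)

lemma tychonoff_space_P_tau: "tychonoff_space (P_tau X)"
  unfolding P_tau_def by (intro tychonoff_space_subtopology tychonoff_space_P_space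
      compact_space_stone_cech Hausdorff_space_stone_cech)

lemma tychonoff_space_P_hat: "tychonoff_space (P_hat X)"
  unfolding P_hat_def by (intro tychonoff_space_subtopology tychonoff_space_P_space
      compact_space_stone_cech Hausdorff_space_stone_cech)

lemma stone_cech_map_image_sc_embed:
  assumes "continuous_map X Y f"
  shows "stone_cech_map X Y f ` (sc_embed X ` topspace X) \<subseteq> sc_embed Y ` topspace Y"
  using stone_cech_map_props(2)[OF assms] continuous_map_image_subset_topspace[OF assms] by auto

lemma P_map_in_P_tau:
  assumes f: "continuous_map X Y f" and M: "M \<in> topspace (P_tau X)"
  shows "P_map (stone_cech X) (stone_cech Y) (stone_cech_map X Y f) M \<in> topspace (P_tau Y)"
proof -
  let ?F = "stone_cech_map X Y f"
  have F: "continuous_map (stone_cech X) (stone_cech Y) ?F"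
    using f by (rule continuous_map_stone_cech_map)
  have M': "M \<in> prob_measures (stone_cech X)"
    and out: "outer_measure_of M (sc_embed X ` topspace X) = 1"
    using M by (auto simp: topspace_P_tau)
  have "outer_measure_of (distr M (borel_sigma (stone_cech Y)) ?F) (sc_embed Y ` topspace Y) = 1"
    using prob_measuresD(3)[OF M']
      continuous_map_measurable_borel_sigma[OF prob_measuresD(1,2)[OF M'] F] _ out
      stone_cech_map_image_sc_embed[OF f]
    by (rule outer_measure_of_distr_eq_1)
      (simp_all add: prob_measuresD(1)[OF M'] sc_embed_image_subset)
  then show ?thesis
    using M' distr_in_prob_measures[OF Hausdorff_space_stone_cech F M']
    by (simp add: topspace_P_tau P_map_def)
qed

lemma P_map_in_P_hat:
  assumes f: "continuous_map X Y f" and M: "M \<in> topspace (P_hat X)"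
  shows "P_map (stone_cech X) (stone_cech Y) (stone_cech_map X Y f) M \<in> topspace (P_hat Y)"
proof -
  let ?F = "stone_cech_map X Y f"
  have F: "continuous_map (stone_cech X) (stone_cech Y) ?F"
    using f by (rule continuous_map_stone_cech_map)
  have M': "M \<in> prob_measures (stone_cech X)"
    and inn: "inner_measure_of M (sc_embed X ` topspace X) = 1"
    using M by (auto simp: topspace_P_hat)
  have "inner_measure_of (distr M (borel_sigma (stone_cech Y)) ?F) (sc_embed Y ` topspace Y) = 1"
    using Hausdorff_space_stone_cech Hausdorff_space_stone_cech F M' inn
      stone_cech_map_image_sc_embed[OF f]
    by (rule inner_measure_of_distr_eq_1)
  then show ?thesis
    using M' distr_in_prob_measures[OF Hausdorff_space_stone_cech F M']
    by (simp add: topspace_P_hat P_map_def)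
qed

lemma P_tau_map_in_cmaps:
  assumes f: "continuous_map X Y f"
  shows "P_tau_map X Y f \<in> cmaps (P_tau X) (P_tau Y)"
proof -
  let ?G = "P_map (stone_cech X) (stone_cech Y) (stone_cech_map X Y f)"
  have "continuous_map (P_space (stone_cech X)) (P_space (stone_cech Y)) ?G"
    using Hausdorff_space_stone_cech continuous_map_stone_cech_map[OF f]
    by (rule continuous_map_P_map)
  then have "continuous_map (P_tau X) (P_space (stone_cech Y)) ?G"
    unfolding P_tau_def by (rule continuous_map_from_subtopology)
  then have "continuous_map (P_tau X) (P_tau Y) ?G"
    using P_map_in_P_tau[OF f] unfolding P_tau_def[of Y] continuous_map_in_subtopology
    by (auto simp: P_tau_def)
  then have "continuous_map (P_tau X) (P_tau Y) (restrict ?G (topspace (P_tau X)))"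
    by (rule continuous_map_eq) simp
  then show ?thesis
    by (simp add: cmaps_def P_tau_map_def)
qed

lemma P_hat_map_in_cmaps:
  assumes f: "continuous_map X Y f"
  shows "P_hat_map X Y f \<in> cmaps (P_hat X) (P_hat Y)"
proof -
  let ?G = "P_map (stone_cech X) (stone_cech Y) (stone_cech_map X Y f)"
  have "continuous_map (P_space (stone_cech X)) (P_space (stone_cech Y)) ?G"
    using Hausdorff_space_stone_cech continuous_map_stone_cech_map[OF f]
    by (rule continuous_map_P_map)
  then have "continuous_map (P_hat X) (P_space (stone_cech Y)) ?G"
    unfolding P_hat_def by (rule continuous_map_from_subtopology)
  then have "continuous_map (P_hat X) (P_hat Y) ?G"
    using P_map_in_P_hat[OF f] unfolding P_hat_def[of Y] continuous_map_in_subtopology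
    by (auto simp: P_hat_def)
  then have "continuous_map (P_hat X) (P_hat Y) (restrict ?G (topspace (P_hat X)))"
    by (rule continuous_map_eq) simp
  then show ?thesis
    by (simp add: cmaps_def P_hat_map_def)
qed

lemma P_tau_map_ident:
  "P_tau_map X X (restrict id (topspace X)) = restrict id (topspace (P_tau X))"
  unfolding P_tau_map_def
  by (rule restrict_ext) (simp add: topspace_P_tau P_map_stone_cech_ident)

lemma P_hat_map_ident:
  "P_hat_map X X (restrict id (topspace X)) = restrict id (topspace (P_hat X))"
  unfolding P_hat_map_def
  by (rule restrict_ext) (simp add: topspace_P_hat P_map_stone_cech_ident)

lemma P_tau_map_compose:
  assumes f: "continuous_map X Y f" and g: "continuous_map Y Z g"
  shows "P_tau_map X Z (compose (topspace X) g f) =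
    compose (topspace (P_tau X)) (P_tau_map Y Z g) (P_tau_map X Y f)"
proof -
  have "M \<in> prob_measures (stone_cech X)" if "M \<in> topspace (P_tau X)" for M
    using that by (simp add: topspace_P_tau)
  then show ?thesis
    unfolding P_tau_map_def compose_def[of "topspace (P_tau X)"]
    by (intro restrict_ext) (simp add: P_map_in_P_tau[OF f] P_map_stone_cech_compose[OF f g])
qed

lemma P_hat_map_compose:
  assumes f: "continuous_map X Y f" and g: "continuous_map Y Z g"
  shows "P_hat_map X Z (compose (topspace X) g f) =
    compose (topspace (P_hat X)) (P_hat_map Y Z g) (P_hat_map X Y f)"
proof -
  have "M \<in> prob_measures (stone_cech X)" if "M \<in> topspace (P_hat X)" for M
    using that by (simp add: topspace_P_hat)
  then show ?thesis
    unfolding P_hat_map_def compose_def[of "topspace (P_hat X)"]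
    by (intro restrict_ext) (simp add: P_map_in_P_hat[OF f] P_map_stone_cech_compose[OF f g])
qed


section \<open>Compact Hausdorff spaces\<close>

lemma outer_measure_of_space_eq_1:
  assumes "prob_space M" shows "outer_measure_of M (space M) = 1"
  using assms by (simp add: outer_measure_of_eq prob_space.emeasure_space_1)

lemma inner_measure_of_space_eq_1:
  assumes "prob_space M" shows "inner_measure_of M (space M) = 1"
proof (rule antisym)
  interpret prob_space M by fact
  show "inner_measure_of M (space M) \<le> 1"
    unfolding inner_measure_of_def by (intro SUP_least emeasure_le_1)
  have "emeasure M (space M) \<le> inner_measure_of M (space M)"
    unfolding inner_measure_of_def by (intro SUP_upper) auto
  then show "1 \<le> inner_measure_of M (space M)"
    by (simp add: emeasure_space_1)
qed

lemma sc_embed_image_compact: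
  assumes "compact_space K" "Hausdorff_space K"
  shows "sc_embed K ` topspace K = topspace (stone_cech K)"
  using homeomorphic_map_sc_embed[OF assms] by (rule homeomorphic_imp_surjective_map)

lemma P_tau_compact:
  assumes "compact_space K" "Hausdorff_space K"
  shows "P_tau K = P_space (stone_cech K)"
  unfolding P_tau_def sc_embed_image_compact[OF assms]
  by (rule subtopology_superset)
    (use outer_measure_of_space_eq_1 in \<open>fastforce simp: topspace_P_space prob_measures_def\<close>)

lemma P_hat_compact:
  assumes "compact_space K" "Hausdorff_space K"
  shows "P_hat K = P_space (stone_cech K)"
  unfolding P_hat_def sc_embed_image_compact[OF assms]
  by (rule subtopology_superset)
    (use inner_measure_of_space_eq_1 in \<open>fastforce simp: topspace_P_space prob_measures_def\<close>)

lemma homeomorphic_map_P_map_sc_embed: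
  assumes "compact_space K" "Hausdorff_space K"
  shows "homeomorphic_map (P_space K) (P_space (stone_cech K))
    (P_map K (stone_cech K) (sc_embed K))"
  using assms(2) Hausdorff_space_stone_cech homeomorphic_map_sc_embed[OF assms]
  by (rule homeomorphic_map_P_map)

lemma P_tau_map_natural:
  assumes K: "compact_space K" "Hausdorff_space K" and L: "Hausdorff_space L"
    and f: "continuous_map K L f"
  shows "compose (topspace (P_space K)) (P_tau_map K L f) (P_map K (stone_cech K) (sc_embed K)) =
    compose (topspace (P_space K)) (P_map L (stone_cech L) (sc_embed L)) (P_map K L f)"
  unfolding compose_def
  by (rule restrict_ext)
    (simp add: P_tau_map_def P_tau_compact[OF K] topspace_P_space P_map_stone_cech_natural[OF f L]
      P_map_in_prob_measures Hausdorff_space_stone_cech continuous_map_sc_embed)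

lemma P_hat_map_natural:
  assumes K: "compact_space K" "Hausdorff_space K" and L: "Hausdorff_space L"
    and f: "continuous_map K L f"
  shows "compose (topspace (P_space K)) (P_hat_map K L f) (P_map K (stone_cech K) (sc_embed K)) =
    compose (topspace (P_space K)) (P_map L (stone_cech L) (sc_embed L)) (P_map K L f)"
  unfolding compose_def
  by (rule restrict_ext)
    (simp add: P_hat_map_def P_hat_compact[OF K] topspace_P_space P_map_stone_cech_natural[OF f L]
      P_map_in_prob_measures Hausdorff_space_stone_cech continuous_map_sc_embed)


section \<open>The functors and their agreement with the functor of probability measures\<close>

theorem theorem0p1:
  "\<comment> \<open>\<open>P\<^sub>\<tau>\<close> is an endofunctor of the category of Tychonoff spaces\<close>
   (\<forall>X::'a topology. tychonoff_space X \<longrightarrow> tychonoff_space (P_tau X)) \<and>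
   (\<forall>(X::'a topology) (Y::'b topology). tychonoff_space X \<longrightarrow> tychonoff_space Y \<longrightarrow>
      (\<forall>f\<in>cmaps X Y. P_tau_map X Y f \<in> cmaps (P_tau X) (P_tau Y))) \<and>
   (\<forall>X::'a topology. tychonoff_space X \<longrightarrow>
      P_tau_map X X (restrict id (topspace X)) = restrict id (topspace (P_tau X))) \<and>
   (\<forall>(X::'a topology) (Y::'b topology) (Z::'c topology).
      tychonoff_space X \<longrightarrow> tychonoff_space Y \<longrightarrow> tychonoff_space Z \<longrightarrow>
      (\<forall>f\<in>cmaps X Y. \<forall>g\<in>cmaps Y Z.
         P_tau_map X Z (compose (topspace X) g f) =
         compose (topspace (P_tau X)) (P_tau_map Y Z g) (P_tau_map X Y f))) \<and>
   \<comment> \<open>\<open>P\<close>-hat is an endofunctor of the category of Tychonoff spaces\<close>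
   (\<forall>X::'a topology. tychonoff_space X \<longrightarrow> tychonoff_space (P_hat X)) \<and>
   (\<forall>(X::'a topology) (Y::'b topology). tychonoff_space X \<longrightarrow> tychonoff_space Y \<longrightarrow>
      (\<forall>f\<in>cmaps X Y. P_hat_map X Y f \<in> cmaps (P_hat X) (P_hat Y))) \<and>
   (\<forall>X::'a topology. tychonoff_space X \<longrightarrow>
      P_hat_map X X (restrict id (topspace X)) = restrict id (topspace (P_hat X))) \<and>
   (\<forall>(X::'a topology) (Y::'b topology) (Z::'c topology).
      tychonoff_space X \<longrightarrow> tychonoff_space Y \<longrightarrow> tychonoff_space Z \<longrightarrow>
      (\<forall>f\<in>cmaps X Y. \<forall>g\<in>cmaps Y Z.
         P_hat_map X Z (compose (topspace X) g f) =
         compose (topspace (P_hat X)) (P_hat_map Y Z g) (P_hat_map X Y f))) \<and>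
   \<comment> \<open>both extend \<open>P\<close>, a compact Hausdorff space \<open>K\<close> being identified with \<open>\<beta>K\<close> by \<open>sc_embed K\<close>\<close>
   (\<forall>K::'a topology. compact_space K \<longrightarrow> Hausdorff_space K \<longrightarrow>
      P_tau K = P_space (stone_cech K) \<and>
      P_hat K = P_space (stone_cech K) \<and>
      homeomorphic_map (P_space K) (P_tau K) (P_map K (stone_cech K) (sc_embed K)) \<and>
      homeomorphic_map (P_space K) (P_hat K) (P_map K (stone_cech K) (sc_embed K))) \<and>
   (\<forall>(K::'a topology) (L::'b topology).
      compact_space K \<longrightarrow> Hausdorff_space K \<longrightarrow> compact_space L \<longrightarrow> Hausdorff_space L \<longrightarrow>
      (\<forall>f\<in>cmaps K L.
         compose (topspace (P_space K)) (P_tau_map K L f) (P_map K (stone_cech K) (sc_embed K)) =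
         compose (topspace (P_space K)) (P_map L (stone_cech L) (sc_embed L)) (P_map K L f) \<and>
         compose (topspace (P_space K)) (P_hat_map K L f) (P_map K (stone_cech K) (sc_embed K)) =
         compose (topspace (P_space K)) (P_map L (stone_cech L) (sc_embed L)) (P_map K L f)))"
proof -
  have cont: "continuous_map X Y f" if "f \<in> cmaps X Y"
    for X :: "'x topology" and Y :: "'y topology" and f
    using that by (simp add: cmaps_def)
  have homeo: "homeomorphic_map (P_space K) (P_tau K) (P_map K (stone_cech K) (sc_embed K))"
    "homeomorphic_map (P_space K) (P_hat K) (P_map K (stone_cech K) (sc_embed K))"
    if "compact_space K" "Hausdorff_space K" for K :: "'x topology"
    using that by (simp_all only: P_tau_compact P_hat_compact homeomorphic_map_P_map_sc_embed)
  show ?thesis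
    by (intro conjI allI impI ballI;
        rule tychonoff_space_P_tau tychonoff_space_P_hat
          P_tau_map_in_cmaps P_hat_map_in_cmaps P_tau_map_ident P_hat_map_ident
          P_tau_map_compose P_hat_map_compose P_tau_compact P_hat_compact homeo
          P_tau_map_natural P_hat_map_natural;
        (assumption | erule cont))
qed

end
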